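(* (i) Let $\mathbf P=(P,\leq,{}',0,1)$ be an orthomodular poset of finite height. Then $\mathbb P\big(\mathbb R(\mathbf P)\big)=\mathbf P$. (ii) Let $\mathbf R=(R,\leq,\odot,\rightarrow,0,1)$ be a divisible operator residuated structure of finite height satisfying both the double negation law and the contraposition law. Then $\mathbb R\big(\mathbb P(\mathbf R)\big)=\mathbf R$ if and only if for all $x,y\in R$ $$\operatorname{Min}U(x,y\rightarrow 0)\wedge y=x\odot y\quad\text{and}\quad(x\rightarrow 0)\vee\operatorname{Max}L(x,y)=x\rightarrow y.$$
   Context: Orthomodular poset: a bounded poset $(P,\leq,{}',0,1)$ with a unary operation $'$ that is an antitone involution ($x\le y$ implies $y'\le x'$; $x''=x$) and a complementation ($x\vee x'=1$ and $x\wedge x'=0$ for all $x$), such that: if $x\leq y'$ then the join $x\vee y$ exists; and if $x\leq y$ then $y=x\vee(y'\vee x)'$. A poset is of finite height if it contains no infinite chain. Set notation in a poset $(P,\le)$: for $A,B\subseteq P$, $A\leq B$ means $x\leq y$ for all $x\in A$, $y\in B$; $L(x,y)$ and $U(x,y)$ are the sets of common lower and common upper bounds of $x,y$; $\operatorname{Min}A$ and $\operatorname{Max}A$ are the sets of minimal and maximal elements of $A$. Lattice operations on sets are elementwise: $A\wedge y=\{a\wedge y\mid a\in A\}$, $x\vee A=\{x\vee a\mid a\in A\}$, etc. Elements $x$ are identified with singletons $\{x\}$. For non-empty $A,B\subseteq P$: $A\sqsubseteq B$ iff there are $a\in A$ and $b\in B$ with $a\leq b$. For a mapping $\otimes\colon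 P^2\to 2^P$, $A\subseteq P$ and $y\in P$ put $A\otimes y:=\bigcup_{x\in A}(x\otimes y)$. An operator residuated structure is a six-tuple $(P,\leq,\odot,\rightarrow,0,1)$ such that for all $x,y,z\in P$: (i) $(P,\leq,0,1)$ is a bounded poset; (ii) $\odot$ and $\rightarrow$ are mappings from $P^2$ to $2^P\setminus\{\emptyset\}$; (iii) $x\odot y\sqsubseteq z$ if and only if $x\sqsubseteq y\rightarrow z$; (iv) $x\odot 1=1\odot x=x$; (v) $y\rightarrow 0\leq x$ implies $x\odot y=x\wedge y$ (in particular the meet exists); (vi) $y\leq x$ implies $x\rightarrow y=(x\rightarrow 0)\vee y$ (in particular the joins exist). It is of finite height if $(P,\le)$ is. It is divisible if $(x\rightarrow y)\odot x=\operatorname{Max}L(x,y)$ for all $x,y$; it satisfies the double negation law if $(x\rightarrow 0)\rightarrow 0=x$ for all $x$; it satisfies the contraposition law if $x\leq y$ implies $y\rightarrow 0\leq x\rightarrow 0$. For an orthomodular poset $\mathbf P=(P,\leq,{}',0,1)$ of finite height, $\mathbb R(\mathbf P):=(P,\leq,\odot,\rightarrow,0,1)$ with $x\odot y:=\operatorname{Min}U(x,y')\wedge y$ and $x\rightarrow y:=x'\vee\operatorname{Max}L(x,y)$; it is a divisible operator residuated structure of finite height satisfying the double negation and contraposition laws. For a divisible operator residuated structure $\mathbf R=(R,\leq,\odot,\rightarrow,0,1)$ of finite height satisfying the double negation and contraposition laws, $\mathbb P(\mathbf R):=(R,\leq,{}',0,1)$ with $x':=x\rightarrow 0$ (each set $x\rightarrow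 0$ is then a singleton, identified with its element); it is an orthomodular poset of finite height. *)

theory Defs
  imports Main
begin

text \<open>The carrier of a structure is the whole type \<open>'a\<close>, so that equality of
  structures is equality of records.\<close>

record 'a bounded =
  le :: "'a \<Rightarrow> 'a \<Rightarrow> bool"
  zero :: 'a
  one :: 'a

record 'a ortho = "'a bounded" +
  compl :: "'a \<Rightarrow> 'a"

record 'a op_res = "'a bounded" +
  odot :: "'a \<Rightarrow> 'a \<Rightarrow> 'a set"
  arrow :: "'a \<Rightarrow> 'a \<Rightarrow> 'a set"

definition bounded_poset :: "('a, 'b) bounded_scheme \<Rightarrow> bool" where
  "bounded_poset P \<longleftrightarrow>
     reflp (le P) \<and> transp (le P) \<and> antisymp (le P) \<and>
     (\<forall>x. le P (zero P) x \<and> le P x (one P))"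

definition finite_height :: "('a, 'b) bounded_scheme \<Rightarrow> bool" where
  "finite_height P \<longleftrightarrow> (\<forall>C. Complete_Partial_Order.chain (le P) C \<longrightarrow> finite C)"

definition lower_bounds :: "('a, 'b) bounded_scheme \<Rightarrow> 'a set \<Rightarrow> 'a set" where
  "lower_bounds P A = {z. \<forall>a\<in>A. le P z a}"

definition upper_bounds :: "('a, 'b) bounded_scheme \<Rightarrow> 'a set \<Rightarrow> 'a set" where
  "upper_bounds P A = {z. \<forall>a\<in>A. le P a z}"

definition minimals :: "('a, 'b) bounded_scheme \<Rightarrow> 'a set \<Rightarrow> 'a set" where
  "minimals P A = {m \<in> A. \<forall>a\<in>A. le P a m \<longrightarrow> a = m}"

definition maximals :: "('a, 'b) bounded_scheme \<Rightarrow> 'a set \<Rightarrow> 'a set" where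
  "maximals P A = {m \<in> A. \<forall>a\<in>A. le P m a \<longrightarrow> a = m}"

definition is_meet :: "('a, 'b) bounded_scheme \<Rightarrow> 'a \<Rightarrow> 'a \<Rightarrow> 'a \<Rightarrow> bool" where
  "is_meet P x y m \<longleftrightarrow> m \<in> lower_bounds P {x, y} \<and> (\<forall>z\<in>lower_bounds P {x, y}. le P z m)"

definition is_join :: "('a, 'b) bounded_scheme \<Rightarrow> 'a \<Rightarrow> 'a \<Rightarrow> 'a \<Rightarrow> bool" where
  "is_join P x y j \<longleftrightarrow> j \<in> upper_bounds P {x, y} \<and> (\<forall>z\<in>upper_bounds P {x, y}. le P j z)"

text \<open>Elementwise meets and joins of sets; elements are passed as singletons. A pair without a
  meet (join) would contribute nothing, so existence is required separately where it is part
  of an axiom. It is automatic in \<open>res_of\<close> applied to an orthomodular poset: there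
  \<open>a \<in> Min U(x,y')\<close> satisfies \<open>y' \<le> a\<close>, so \<open>a \<and> y = (a' \<or> y')'\<close> exists, and
  \<open>b \<in> Max L(x,y)\<close> satisfies \<open>b \<le> x = x''\<close>, so \<open>x' \<or> b\<close> exists.\<close>

definition meet_sets :: "('a, 'b) bounded_scheme \<Rightarrow> 'a set \<Rightarrow> 'a set \<Rightarrow> 'a set" where
  "meet_sets P A B = {m. \<exists>a\<in>A. \<exists>b\<in>B. is_meet P a b m}"

definition join_sets :: "('a, 'b) bounded_scheme \<Rightarrow> 'a set \<Rightarrow> 'a set \<Rightarrow> 'a set" where
  "join_sets P A B = {j. \<exists>a\<in>A. \<exists>b\<in>B. is_join P a b j}"

definition sqsub :: "('a, 'b) bounded_scheme \<Rightarrow> 'a set \<Rightarrow> 'a set \<Rightarrow> bool" where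
  "sqsub P A B \<longleftrightarrow> (\<exists>a\<in>A. \<exists>b\<in>B. le P a b)"

definition lift_left :: "('a \<Rightarrow> 'a \<Rightarrow> 'a set) \<Rightarrow> 'a set \<Rightarrow> 'a \<Rightarrow> 'a set" where
  "lift_left f A y = (\<Union>x\<in>A. f x y)"

text \<open>In the orthomodular law \<open>y = x \<or> (y' \<or> x)'\<close> the witness \<open>j\<close> is \<open>y' \<or> x\<close>.\<close>

definition orthomodular_poset :: "'a ortho \<Rightarrow> bool" where
  "orthomodular_poset P \<longleftrightarrow>
     bounded_poset P \<and>
     (\<forall>x y. le P x y \<longrightarrow> le P (compl P y) (compl P x)) \<and>
     (\<forall>x. compl P (compl P x) = x) \<and>
     (\<forall>x. is_join P x (compl P x) (one P)) \<and>
     (\<forall>x. is_meet P x (compl P x) (zero P)) \<and>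
     (\<forall>x y. le P x (compl P y) \<longrightarrow> (\<exists>j. is_join P x y j)) \<and>
     (\<forall>x y. le P x y \<longrightarrow> (\<exists>j. is_join P (compl P y) x j \<and> is_join P x (compl P j) y))"

definition operator_residuated :: "'a op_res \<Rightarrow> bool" where
  "operator_residuated R \<longleftrightarrow>
     bounded_poset R \<and>
     (\<forall>x y. odot R x y \<noteq> {} \<and> arrow R x y \<noteq> {}) \<and>
     (\<forall>x y z. sqsub R (odot R x y) {z} \<longleftrightarrow> sqsub R {x} (arrow R y z)) \<and>
     (\<forall>x. odot R x (one R) = {x} \<and> odot R (one R) x = {x}) \<and>
     (\<forall>x y. (\<forall>a\<in>arrow R y (zero R). le R a x) \<longrightarrow>
        (\<exists>m. is_meet R x y m \<and> odot R x y = {m})) \<and>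
     (\<forall>x y. le R y x \<longrightarrow>
        (\<forall>a\<in>arrow R x (zero R). \<exists>j. is_join R a y j) \<and>
        arrow R x y = join_sets R (arrow R x (zero R)) {y})"

definition divisible :: "'a op_res \<Rightarrow> bool" where
  "divisible R \<longleftrightarrow>
     (\<forall>x y. lift_left (odot R) (arrow R x y) x = maximals R (lower_bounds R {x, y}))"

definition double_negation :: "'a op_res \<Rightarrow> bool" where
  "double_negation R \<longleftrightarrow>
     (\<forall>x. lift_left (arrow R) (arrow R x (zero R)) (zero R) = {x})"

definition contraposition :: "'a op_res \<Rightarrow> bool" where
  "contraposition R \<longleftrightarrow>
     (\<forall>x y. le R x y \<longrightarrow>
        (\<forall>a\<in>arrow R y (zero R). \<forall>b\<in>arrow R x (zero R). le R a b))"

definition res_of :: "'a ortho \<Rightarrow> 'a op_res" where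
  "res_of P =
     \<lparr>le = le P, zero = zero P, one = one P,
      odot = (\<lambda>x y. meet_sets P (minimals P (upper_bounds P {x, compl P y})) {y}),
      arrow = (\<lambda>x y. join_sets P {compl P x} (maximals P (lower_bounds P {x, y})))\<rparr>"

text \<open>\<open>the_elem\<close> is meant to be used only under the double negation law, which makes every set
  \<open>arrow R x (zero R)\<close> a singleton.\<close>

definition ortho_of :: "'a op_res \<Rightarrow> 'a ortho" where
  "ortho_of R =
     \<lparr>le = le R, zero = zero R, one = one R,
      compl = (\<lambda>x. the_elem (arrow R x (zero R)))\<rparr>"

lemma double_negation_singleton:
  assumes "operator_residuated R" "double_negation R"
  shows "\<exists>a. arrow R x (zero R) = {a}"
proof -
  have ne: "arrow R u v \<noteq> {}" for u v
    using assms(1) by (auto simp: operator_residuated_def)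
  have dn: "(\<Union>a\<in>arrow R u (zero R). arrow R a (zero R)) = {u}" for u
    using assms(2) by (auto simp: double_negation_def lift_left_def)
  obtain a where a: "a \<in> arrow R x (zero R)"
    using ne by blast
  have "arrow R a (zero R) \<subseteq> {x}"
    unfolding dn[of x, symmetric] using a by (rule UN_upper)
  then have "arrow R a (zero R) = {x}"
    using ne[of a "zero R"] by (simp add: subset_singleton_iff)
  then have "arrow R x (zero R) = {a}"
    using dn[of a] by simp
  then show ?thesis ..
qed

end

theory Submission
  imports Defs
begin

text \<open>Both constructions keep the order and the bounds, so only the operations have to be
  compared. Starting from P, \<open>L(x,0) = {0}\<close> gives
  \<open>x \<rightarrow> 0 = x' \<or> 0 = x'\<close>, which recovers the complement
  (\<open>arrow_res_of_zero\<close>). Starting from R, double negation makes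
  \<open>x \<rightarrow> 0\<close> a singleton, hence equal to \<open>{x'}\<close>; the operations
  rebuilt from \<open>x'\<close> are then literally the left-hand sides of the two identities, and
  equality of the structures is equality of these operations
  (\<open>res_of_ortho_of_eq_iff\<close>).\<close>

lemma bounds_ortho_of [simp]:
  "lower_bounds (ortho_of R) = lower_bounds R"
  "upper_bounds (ortho_of R) = upper_bounds R"
  by (simp_all add: fun_eq_iff lower_bounds_def upper_bounds_def ortho_of_def)

lemma extremals_ortho_of [simp]:
  "minimals (ortho_of R) = minimals R"
  "maximals (ortho_of R) = maximals R"
  by (simp_all add: fun_eq_iff minimals_def maximals_def ortho_of_def)

lemma meet_join_sets_ortho_of [simp]:
  "meet_sets (ortho_of R) = meet_sets R"
  "join_sets (ortho_of R) = join_sets R"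
  \<comment> \<open>\<open>ortho_of\<close> stays folded here so that the rules for bounds can fire;
    unfolding it afterwards settles the remaining occurrences of \<open>le\<close>.\<close>
  by (simp_all add: fun_eq_iff meet_sets_def join_sets_def is_meet_def is_join_def)
    (simp_all add: ortho_of_def)

lemma maximals_lower_bounds_zero:
  assumes "bounded_poset P"
  shows "maximals P (lower_bounds P {x, zero P}) = {zero P}"
proof -
  have "lower_bounds P {x, zero P} = {zero P}"
    using assms by (auto simp: bounded_poset_def lower_bounds_def dest: antisympD)
  then show ?thesis
    by (auto simp: maximals_def)
qed

text \<open>The join with the bottom always exists, so the pair is not silently dropped by
  \<open>join_sets\<close>; antisymmetry makes the join unique.\<close>

lemma join_sets_zero:
  assumes "bounded_poset P"
  shows "join_sets P {x} {zero P} = {x}"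
  using assms
  by (auto simp: bounded_poset_def join_sets_def is_join_def upper_bounds_def
      dest: antisympD reflpD)

lemma arrow_res_of_zero:
  assumes "bounded_poset P"
  shows "arrow (res_of P) x (zero P) = {compl P x}"
  using assms by (simp add: res_of_def maximals_lower_bounds_zero join_sets_zero)

lemma ortho_of_res_of:
  fixes P :: "'a ortho"
  assumes "bounded_poset P"
  shows "ortho_of (res_of P) = P"
proof -
  have "le (res_of P) = le P" "zero (res_of P) = zero P" "one (res_of P) = one P"
    by (simp_all add: res_of_def)
  then show ?thesis
    using assms by (simp add: ortho_of_def arrow_res_of_zero)
qed

lemma res_of_ortho_of_eq_iff:
  fixes R :: "'a op_res"
  assumes single: "\<And>x. \<exists>a. arrow R x (zero R) = {a}"
  shows "res_of (ortho_of R) = R \<longleftrightarrow>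
    (\<forall>x y. meet_sets R (minimals R (upper_bounds R (insert x (arrow R y (zero R))))) {y}
             = odot R x y \<and>
           join_sets R (arrow R x (zero R)) (maximals R (lower_bounds R {x, y}))
             = arrow R x y)"
proof -
  \<comment> \<open>On a singleton \<open>the_elem\<close> returns its only member, so no
    information is lost.\<close>
  have compl: "{compl (ortho_of R) x} = arrow R x (zero R)" for x
  proof -
    obtain a where "arrow R x (zero R) = {a}"
      using single by blast
    then show ?thesis
      by (simp add: ortho_of_def)
  qed
  have odot: "odot (res_of (ortho_of R)) x y =
      meet_sets R (minimals R (upper_bounds R (insert x (arrow R y (zero R))))) {y}" for x y
    \<comment> \<open>Read backwards, \<open>compl\<close> turns
      \<open>insert x (arrow R y (zero R))\<close> into the pair \<open>{x, y'}\<close> that occurs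
      in \<open>res_of\<close>.\<close>
    unfolding compl[symmetric] by (simp add: res_of_def)
  have arrow: "arrow (res_of (ortho_of R)) x y =
      join_sets R (arrow R x (zero R)) (maximals R (lower_bounds R {x, y}))" for x y
    unfolding compl[symmetric] by (simp add: res_of_def)
  have "le (res_of (ortho_of R)) = le R" "zero (res_of (ortho_of R)) = zero R"
    "one (res_of (ortho_of R)) = one R"
    by (simp_all add: res_of_def ortho_of_def)
  then have "res_of (ortho_of R) = R \<longleftrightarrow>
      odot (res_of (ortho_of R)) = odot R \<and> arrow (res_of (ortho_of R)) = arrow R"
    \<comment> \<open>Record equality also compares the extension slot \<open>more\<close>, which
      has type \<open>unit\<close>.\<close>
    by (metis (full_types) op_res.equality unit_eq)
  then show ?thesis
    unfolding fun_eq_iff odot arrow by blast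
qed

theorem theorem10:
  fixes P :: "'a ortho" and R :: "'b op_res"
  shows "(orthomodular_poset P \<and> finite_height P \<longrightarrow> ortho_of (res_of P) = P) \<and>
    (operator_residuated R \<and> finite_height R \<and> divisible R \<and>
       double_negation R \<and> contraposition R \<longrightarrow>
     (res_of (ortho_of R) = R \<longleftrightarrow>
      (\<forall>x y. meet_sets R (minimals R (upper_bounds R (insert x (arrow R y (zero R))))) {y}
               = odot R x y \<and>
             join_sets R (arrow R x (zero R)) (maximals R (lower_bounds R {x, y}))
               = arrow R x y)))"
  by (intro conjI impI ortho_of_res_of res_of_ortho_of_eq_iff)
    (auto simp: orthomodular_poset_def intro: double_negation_singleton)

end
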